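(* Let $m\ge 3$ be an integer with prime factorization $m=p_{1}^{r_{1}}\cdots p_{k}^{r_{k}}$, and let $a$ be an integer with $\gcd(a,m)=1$. Then the following statements are equivalent: (1) $m$ is a Carmichael-Wieferich number with base $a$; (2) $e(m,p_{j})+\sigma(a,p_{j})\ge r_{j}$ for every $1\le j\le k$.
   Context: $\lambda$ denotes the Carmichael function: $\lambda(m)$ is the exponent of $(\mathbb{Z}/m\mathbb{Z})^{*}$. For coprime integers $m\ge 2$ and $a$, the Carmichael quotient is $C_{m}(a)=\frac{a^{\lambda(m)}-1}{m}$; $m$ is a Carmichael-Wieferich number with base $a$ if $C_{m}(a)\equiv 0\pmod m$. For a prime $p$, $\mathrm{ord}_p$ denotes the $p$-adic valuation on integers, with $\mathrm{ord}_p(0)=\infty$. For a prime $p$ and an integer $a$ with $p\nmid a$, put $\sigma(a,p)=\mathrm{ord}_{p}(a^{p-1}-1)-1$ if $p$ is odd; and $\sigma(a,2)=\mathrm{ord}_{2}(a-1)-1$ if $a\equiv1\pmod 4$, $\sigma(a,2)=\mathrm{ord}_{2}(a+1)-1$ if $a\equiv 3\pmod 4$. For $m=p_{1}^{r_{1}}\cdots p_{k}^{r_{k}}\ge 3$ and $p=p_j$, $r=r_j$, let $L=\mathrm{ord}_{p}\big(\mathrm{lcm}(p_{1}-1,\dots,p_{k}-1)\big)$. If $p\ne 2$ or $r\le 2$, put $n=0$ if $L\le r-1$ and $n=L-r+1$ otherwise, and set $e(m,p)=n$. If $p=2$ and $r>2$, put $n=0$ if $L\le r-2$ and $n=L-r+2$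 otherwise, and set $e(m,p)=n-1$. *)

theory Defs
  imports "HOL-Number_Theory.Number_Theory" "HOL-Library.Extended"
begin

text \<open>
  The Carmichael function is the library's \<^const>\<open>Carmichael\<close>, the least common multiple of the
  orders of the units modulo \<open>m\<close>, i.e. the exponent of the unit group.
  The \<open>div\<close> below is exact in the case of interest, see \<open>Carmichael_quotient_mult\<close>.
\<close>
definition Carmichael_quotient :: "nat \<Rightarrow> int \<Rightarrow> int" where
  "Carmichael_quotient m a = (a ^ Carmichael m - 1) div int m"

lemma Carmichael_quotient_mult:
  assumes "m \<ge> 2" "coprime a (int m)"
  shows "int m * Carmichael_quotient m a = a ^ Carmichael m - 1"
proof -
  define b where "b = nat (a mod int m)"
  have b: "int b = a mod int m"
    using assms(1) by (simp add: b_def)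
  have "coprime (int b) (int m)"
    using assms by (simp add: b coprime_mod_left_iff)
  hence "[b ^ Carmichael m = 1] (mod m)"
    by (intro Carmichael_divides) (auto simp: coprime_commute)
  hence "[int b ^ Carmichael m = 1] (mod int m)"
    by (metis cong_int_iff of_nat_1 of_nat_power)
  hence "[a ^ Carmichael m = 1] (mod int m)"
    by (simp add: b cong_def power_mod)
  thus ?thesis
    by (simp add: Carmichael_quotient_def cong_iff_dvd_diff)
qed

definition Carmichael_Wieferich :: "nat \<Rightarrow> int \<Rightarrow> bool" where
  "Carmichael_Wieferich m a \<longleftrightarrow>
     m \<ge> 2 \<and> coprime a (int m) \<and> [Carmichael_quotient m a = 0] (mod int m)"

text \<open>
  Valuations take values in the integers extended by \<^const>\<open>Pinf\<close>, since \<open>\<sigma>(a,p)\<close> is infinite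
  for example when \<open>a = 1\<close>, while \<open>e(m,2)\<close> can be \<open>-1\<close>.
  (The library's \<^const>\<open>multiplicity\<close> has \<open>multiplicity p 0 = 0\<close>.)
\<close>
definition padic_ord :: "nat \<Rightarrow> int \<Rightarrow> int extended" where
  "padic_ord p x = (if x = 0 then Pinf else Fin (int (multiplicity (int p) x)))"

text \<open>
  Meant for primes \<open>p\<close> not dividing \<open>a\<close>; so for \<open>p = 2\<close> the last case is \<open>a \<equiv> 3 (mod 4)\<close>.
\<close>
definition sigma :: "int \<Rightarrow> nat \<Rightarrow> int extended" where
  "sigma a p =
     (if p \<noteq> 2 then padic_ord p (a ^ (p - 1) - 1) - 1
      else if [a = 1] (mod 4) then padic_ord 2 (a - 1) - 1
      else padic_ord 2 (a + 1) - 1)"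

definition e_exp :: "nat \<Rightarrow> nat \<Rightarrow> int" where
  "e_exp m p =
     (let r = int (multiplicity p m);
          L = int (multiplicity p (LCM q\<in>prime_factors m. q - 1))
      in if p \<noteq> 2 \<or> r \<le> 2
         then (if L \<le> r - 1 then 0 else L - r + 1)
         else (if L \<le> r - 2 then 0 else L - r + 2) - 1)"

end

theory Submission
  imports Defs
begin

text \<open>
  The number \<open>m\<close> is Carmichael-Wieferich with base \<open>a\<close> iff \<open>m\<^sup>2\<close> divides \<open>a ^ \<lambda>(m) - 1\<close>, i.e. iff
  \<open>ord\<^sub>p (a ^ \<lambda>(m) - 1) \<ge> 2 r\<close> for every prime power \<open>p ^ r\<close> exactly dividing \<open>m\<close>. Since \<open>\<lambda>(m)\<close> is
  even and divisible by \<open>p - 1\<close>, lifting the exponent gives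
  \<open>ord\<^sub>p (a ^ \<lambda>(m) - 1) = \<sigma>(a,p) + 1 + ord\<^sub>p \<lambda>(m)\<close>, and the closed formula for \<open>\<lambda>\<close> shows
  \<open>ord\<^sub>p \<lambda>(m) = max s L\<close>, where \<open>p ^ s\<close> is the power of \<open>p\<close> in \<open>\<lambda>(p ^ r)\<close>; hence
  \<open>ord\<^sub>p \<lambda>(m) + 1 = e(m,p) + r\<close>.
\<close>

section \<open>Valuations with values in the extended integers\<close>

lemma Fin_le_padic_ord_iff:
  assumes "prime p"
  shows "Fin (int k) \<le> padic_ord p x \<longleftrightarrow> int p ^ k dvd x"
proof -
  have "\<not> is_unit (int p)"
    using assms by auto
  thus ?thesis
    by (auto simp: padic_ord_def power_dvd_iff_le_multiplicity)
qed

lemma padic_ord_mult: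
  assumes "prime p"
  shows "padic_ord p (x * y) = padic_ord p x + padic_ord p y"
  using assms by (auto simp: padic_ord_def prime_elem_multiplicity_mult_distrib)

text \<open>Discharges the third case whenever a valuation is split into \<open>Fin\<close>,
  \<open>Pinf\<close> and \<open>Minf\<close>.\<close>

lemma padic_ord_neq_Minf: "padic_ord p x \<noteq> Minf"
  by (simp add: padic_ord_def)

lemma padic_ord_eqI:
  assumes "prime p" "int p ^ k dvd x" "\<not> int p ^ Suc k dvd x"
  shows "padic_ord p x = Fin (int k)"
  using assms by (auto simp: padic_ord_def multiplicity_eqI)

section \<open>Lifting the exponent\<close>

text \<open>Binomial expansion cut off after the linear term: every later term contains
  \<open>u * u\<close>, hence \<open>d\<^sup>2\<close>.\<close>

lemma cong_one_plus_power:
  fixes u d :: int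
  assumes "d dvd u"
  shows "[(1 + u) ^ i = 1 + int i * u] (mod d\<^sup>2)"
proof (induction i)
  case (Suc i)
  have "[u * u = 0] (mod d\<^sup>2)"
    using assms by (simp add: cong_0_iff power2_eq_square mult_dvd_mono)
  hence "[int i * (u * u) = int i * 0] (mod d\<^sup>2)"
    by (rule cong_scalar_left)
  hence *: "[1 + int (Suc i) * u + int i * (u * u) = 1 + int (Suc i) * u + 0] (mod d\<^sup>2)"
    by (intro cong_add) auto
  have "[(1 + u) * (1 + u) ^ i = (1 + u) * (1 + int i * u)] (mod d\<^sup>2)"
    by (rule cong_scalar_left[OF Suc])
  also have "(1 + u) * (1 + int i * u) = 1 + int (Suc i) * u + int i * (u * u)"
    by (simp add: algebra_simps)
  finally show ?case
    using * by (simp add: cong_trans)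
qed simp

text \<open>For \<open>p = 2\<close> the stronger hypothesis \<open>x \<equiv> 1 (mod 4)\<close> is essential: consider \<open>x = 3\<close>.\<close>

lemma cong_sum_powers_prime:
  fixes x :: int
  assumes p: "prime p" and x: "[x = 1] (mod int p)" and x4: "p = 2 \<Longrightarrow> [x = 1] (mod 4)"
  shows "[(\<Sum>i<p. x ^ i) = int p] (mod (int p)\<^sup>2)"
proof (cases "p = 2")
  case True
  have "[1 + x = 1 + 1] (mod 4)"
    using x4 True by (intro cong_add) auto
  thus ?thesis
    using True by (simp add: numeral_2_eq_2)
next
  case False
  define u where "u = x - 1"
  have u: "int p dvd u"
    using x by (simp add: u_def cong_iff_dvd_diff)
  have "odd p"
    using p False prime_odd_nat[of p] prime_ge_2_nat[of p] by linarith
  then obtain h where h: "p = 2 * h + 1"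
    by (elim oddE)
  \<comment> \<open>Oddness of \<open>p\<close> makes the sum p(p-1)/2 a multiple of
    \<open>p\<close>; together with the factor \<open>p\<close> of \<open>u\<close>, the linear
    terms vanish modulo \<open>p\<^sup>2\<close>.\<close>
  have "(\<Sum>i<p. int i) = int p * int h"
  proof -
    have "(\<Sum>i<2 * h + 1. int i) = int (2 * h + 1) * int h"
      by (induction h) (auto simp: algebra_simps)
    thus ?thesis
      using h by simp
  qed
  hence gauss: "(\<Sum>i<p. 1 + int i * u) = int p + int p * u * int h"
    by (simp add: sum.distrib sum_distrib_right[symmetric])
  have "[(\<Sum>i<p. (1 + u) ^ i) = (\<Sum>i<p. 1 + int i * u)] (mod (int p)\<^sup>2)"
    by (intro cong_sum cong_one_plus_power u)
  also note gauss
  also have "[int p + int p * u * int h = int p] (mod (int p)\<^sup>2)"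
    using u by (simp add: cong_iff_dvd_diff power2_eq_square mult_dvd_mono)
  finally show ?thesis
    by (simp add: u_def)
qed

text \<open>The cofactor of \<open>x - 1\<close> in \<open>x ^ n - 1\<close> is a geometric sum
  congruent to \<open>n\<close>, hence prime to \<open>p\<close>.\<close>

lemma padic_ord_power_diff_1_coprime:
  fixes x :: int
  assumes p: "prime p" and x: "[x = 1] (mod int p)" and n: "\<not> p dvd n"
  shows "padic_ord p (x ^ n - 1) = padic_ord p (x - 1)"
proof -
  have "[(\<Sum>i<n. x ^ i) = (\<Sum>i<n. 1 ^ i)] (mod int p)"
    by (intro cong_sum cong_pow x)
  hence "[(\<Sum>i<n. x ^ i) = int n] (mod int p)"
    by simp
  hence "\<not> int p dvd (\<Sum>i<n. x ^ i)"
    using n by (simp add: cong_dvd_iff cong_sym_eq)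
  hence "padic_ord p (\<Sum>i<n. x ^ i) = Fin 0"
    using p padic_ord_eqI[of p 0] by simp
  thus ?thesis
    using p by (cases "padic_ord p (x - 1)")
      (simp_all add: power_diff_1_eq padic_ord_mult padic_ord_neq_Minf)
qed

text \<open>Here the geometric sum is \<open>p\<close> modulo \<open>p\<^sup>2\<close>, so it
  contributes exactly one factor \<open>p\<close>.\<close>

lemma padic_ord_power_prime_diff_1:
  fixes x :: int
  assumes p: "prime p" and x: "[x = 1] (mod int p)" and x4: "p = 2 \<Longrightarrow> [x = 1] (mod 4)"
  shows "padic_ord p (x ^ p - 1) = padic_ord p (x - 1) + 1"
proof -
  let ?S = "\<Sum>i<p. x ^ i"
  have S: "[?S = int p] (mod (int p)\<^sup>2)"
    using assms by (rule cong_sum_powers_prime)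
  have p1: "int p > 1"
    using p prime_gt_1_nat[of p] by simp
  have "\<not> (int p)\<^sup>2 dvd int p"
    using p1 by (auto simp: power2_eq_square dest!: zdvd_imp_le)
  hence "\<not> int p ^ Suc 1 dvd ?S"
    using cong_dvd_iff[OF S] by (simp add: numeral_2_eq_2)
  moreover have "int p ^ 1 dvd ?S"
    using cong_dvd_modulus[OF S, of "int p"] by (simp add: cong_dvd_iff)
  ultimately have "padic_ord p ?S = 1"
    using p padic_ord_eqI[of p 1 ?S] by (simp add: one_extended_def)
  thus ?thesis
    using p by (simp add: power_diff_1_eq padic_ord_mult)
qed

text \<open>Write \<open>n\<close> as \<open>p ^ k * c\<close> with \<open>c\<close> prime to
  \<open>p\<close>: each of the \<open>k\<close> steps of raising to the power \<open>p\<close> adds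
  one, and the exponent \<open>c\<close> changes nothing.\<close>

lemma padic_ord_power_diff_1:
  fixes x :: int
  assumes p: "prime p" and x: "[x = 1] (mod int p)" and x4: "p = 2 \<Longrightarrow> [x = 1] (mod 4)"
    and n: "n > 0"
  shows "padic_ord p (x ^ n - 1) = padic_ord p (x - 1) + Fin (int (multiplicity p n))"
proof -
  \<comment> \<open>Used with \<open>d\<close> equal to \<open>p\<close> and to 4, so that the
    powers of \<open>x\<close> inherit both hypotheses on \<open>x\<close>.\<close>
  have one: "[x ^ k = 1] (mod d)" if "[x = 1] (mod d)" for k and d :: int
    using cong_pow[OF that, of k] by simp
  have pk: "padic_ord p (x ^ p ^ k - 1) = padic_ord p (x - 1) + Fin (int k)" for k
  proof (induction k)
    case 0
    show ?case
      by (cases "padic_ord p (x - 1)") (simp_all add: padic_ord_neq_Minf)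
  next
    case (Suc k)
    have "padic_ord p (x ^ p ^ Suc k - 1) = padic_ord p ((x ^ p ^ k) ^ p - 1)"
      by (simp add: power_mult[symmetric] mult.commute)
    also have "\<dots> = padic_ord p (x ^ p ^ k - 1) + 1"
      by (intro padic_ord_power_prime_diff_1 p one x x4)
    also have "\<dots> = padic_ord p (x - 1) + Fin (int (Suc k))"
      by (cases "padic_ord p (x - 1)") (simp_all add: Suc one_extended_def)
    finally show ?case .
  qed
  obtain c where c: "n = p ^ multiplicity p n * c" "\<not> p dvd c"
    using multiplicity_decompose'[of n p] n p by (metis gr0_conv_Suc nat.distinct(1) not_prime_unit)
  let ?k = "multiplicity p n"
  have "padic_ord p (x ^ n - 1) = padic_ord p ((x ^ p ^ ?k) ^ c - 1)"
    using c(1) by (metis power_mult)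
  also have "\<dots> = padic_ord p (x ^ p ^ ?k - 1)"
    by (intro padic_ord_power_diff_1_coprime p one x c(2))
  finally show ?thesis
    by (simp add: pk)
qed

section \<open>The valuation of \<open>a ^ n - 1\<close> in terms of \<open>sigma\<close>\<close>

text \<open>Of the factors \<open>a - 1\<close> and \<open>a + 1\<close> one is 2 modulo 4 and
  contributes 1; the other is the one in \<open>sigma\<close> and contributes
  \<open>sigma a 2 + 1\<close>.\<close>

lemma padic_ord_2_square_diff_1:
  fixes a :: int
  assumes "odd a"
  shows "padic_ord 2 (a\<^sup>2 - 1) = sigma a 2 + Fin 2"
proof -
  have two: "padic_ord 2 y = Fin 1" if "[y = 2] (mod 4)" for y :: int
  proof -
    have "y mod 4 = 2"
      using that by (simp add: cong_def)
    hence "even y" "\<not> 4 dvd y"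
      by presburger+
    thus ?thesis
      using padic_ord_eqI[of 2 1 y] by simp
  qed
  have split: "padic_ord 2 (a\<^sup>2 - 1) = padic_ord 2 (a - 1) + padic_ord 2 (a + 1)"
    using padic_ord_mult[of 2 "a - 1" "a + 1"] by (simp add: power2_eq_square algebra_simps)
  show ?thesis
  proof (cases "[a = 1] (mod 4)")
    case True
    hence "[a + 1 = 1 + 1] (mod 4)"
      by (intro cong_add) auto
    hence "padic_ord 2 (a + 1) = Fin 1"
      by (simp add: two)
    thus ?thesis
      using True by (cases "padic_ord 2 (a - 1)")
        (simp_all add: split sigma_def one_extended_def padic_ord_neq_Minf)
  next
    case False
    hence "a mod 4 \<noteq> 1"
      by (simp add: cong_def)
    with assms have "(a - 1) mod 4 = 2"
      by presburger
    hence "[a - 1 = 2] (mod 4)"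
      by (simp add: cong_def)
    hence "padic_ord 2 (a - 1) = Fin 1"
      by (rule two)
    thus ?thesis
      using False by (cases "padic_ord 2 (a + 1)")
        (simp_all add: split sigma_def one_extended_def padic_ord_neq_Minf)
  qed
qed

text \<open>Lifting needs a base close to 1. For odd \<open>p\<close> it is
  \<open>a ^ (p - 1)\<close>, and removing \<open>p - 1\<close> from \<open>n\<close> keeps its
  multiplicity. For \<open>p = 2\<close> it is \<open>a\<^sup>2\<close>, as \<open>a\<close> may be
  3 modulo 4; halving \<open>n\<close> costs one, which the 2 in the previous lemma absorbs.\<close>

lemma padic_ord_power_diff_1_sigma:
  fixes a :: int
  assumes p: "prime p" and a: "\<not> int p dvd a" and n: "n > 0" "even n" "p - 1 dvd n"
  shows "padic_ord p (a ^ n - 1) = sigma a p + Fin (int (multiplicity p n) + 1)"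
proof (cases "p = 2")
  case True
  obtain k where k: "n = 2 * k" "k > 0"
    using n by (auto elim!: evenE)
  have "odd a"
    using a True by simp
  hence sq: "[a\<^sup>2 = 1] (mod 4)"
    by (auto elim!: oddE simp: cong_iff_dvd_diff power2_eq_square algebra_simps)
  hence sq2: "[a\<^sup>2 = 1] (mod int 2)"
    by (rule cong_dvd_modulus) simp
  have "multiplicity 2 n = Suc (multiplicity 2 k)"
    using k by (simp add: multiplicity_times_same)
  moreover have "padic_ord 2 ((a\<^sup>2) ^ k - 1) = padic_ord 2 (a\<^sup>2 - 1) + Fin (int (multiplicity 2 k))"
    using sq sq2 k(2) by (intro padic_ord_power_diff_1) auto
  ultimately show ?thesis
    using True k padic_ord_2_square_diff_1[OF \<open>odd a\<close>]
    by (simp add: power_mult add.assoc)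
next
  case False
  obtain k where k: "n = (p - 1) * k"
    using n(3) by (elim dvdE)
  have "k > 0"
    using k n(1) by (intro Nat.gr0I) auto
  have "p > 2"
    using False p prime_ge_2_nat[of p] by linarith
  hence "\<not> p dvd p - 1"
    by (auto dest: dvd_imp_le)
  hence "multiplicity p n = multiplicity p k"
    using p \<open>p > 2\<close> \<open>k > 0\<close> k
    by (simp add: prime_elem_multiplicity_mult_distrib not_dvd_imp_multiplicity_0)
  \<comment> \<open>Fermat's little theorem, read off from
    \<open>Carmichael p = p - 1\<close>.\<close>
  moreover have "[a ^ (p - 1) = 1] (mod int p)"
  proof -
    have "Carmichael p = p - 1"
      using p by (rule Carmichael_prime)
    moreover have "coprime a (int p)"
      using p a prime_imp_coprime[of "int p" a] by (simp add: coprime_commute)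
    ultimately have "int p * Carmichael_quotient p a = a ^ (p - 1) - 1"
      using Carmichael_quotient_mult[of p a] \<open>p > 2\<close> by simp
    thus ?thesis
      by (metis cong_iff_dvd_diff dvd_triv_left)
  qed
  hence "padic_ord p ((a ^ (p - 1)) ^ k - 1)
          = padic_ord p (a ^ (p - 1) - 1) + Fin (int (multiplicity p k))"
    using p False \<open>k > 0\<close> by (intro padic_ord_power_diff_1) auto
  ultimately show ?thesis
    using False k by (cases "padic_ord p (a ^ (p - 1) - 1)")
      (simp_all add: power_mult sigma_def one_extended_def padic_ord_neq_Minf)
qed

section \<open>The power of \<open>p\<close> in the Carmichael function\<close>

text \<open>The valuation of an lcm is the maximum of the valuations; phrased through upper bounds,
  it avoids a maximum over a possibly empty set.\<close>

lemma multiplicity_LCM_le_iff: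
  fixes f :: "'b \<Rightarrow> nat"
  assumes p: "prime p" and "finite A" "\<And>i. i \<in> A \<Longrightarrow> f i > 0"
  shows "multiplicity p (LCM i\<in>A. f i) \<le> k \<longleftrightarrow> (\<forall>i\<in>A. multiplicity p (f i) \<le> k)"
  using assms(2,3)
proof (induction A rule: finite_induct)
  case (insert x A)
  have "0 \<notin> f ` A"
    using insert.prems by fastforce
  hence "(LCM i\<in>A. f i) \<noteq> 0"
    using insert.hyps(1) by (simp add: Lcm_0_iff)
  moreover have "f x \<noteq> 0"
    using insert.prems[of x] by simp
  ultimately have "multiplicity p (lcm (f x) (LCM i\<in>A. f i))
      = max (multiplicity p (f x)) (multiplicity p (LCM i\<in>A. f i))"
    using p by (simp add: multiplicity_lcm)
  thus ?case
    using insert by simp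
qed simp

lemma multiplicity_Carmichael:
  fixes m p :: nat
  assumes p: "p \<in> prime_factors m"
  defines "r \<equiv> multiplicity p m"
  shows "multiplicity p (Carmichael m) =
    max (if p = 2 \<and> r > 2 then r - 2 else r - 1)
      (multiplicity p (LCM q\<in>prime_factors m. q - 1))"
proof -
  \<comment> \<open>\<open>g q\<close> is \<lambda>(q^k), the factor of \<open>q\<close> in the
    closed formula.\<close>
  define g where "g = (\<lambda>q. let k = multiplicity q m
    in if q = 2 \<and> k > 2 then 2 ^ (k - 2) else q ^ (k - 1) * (q - 1))"
  define s where "s = (if p = 2 \<and> r > 2 then r - 2 else r - 1)"
  have "prime p"
    using p by auto
  have gpos: "g q > 0" and q1pos: "q - 1 > 0" if "q \<in> prime_factors m" for q
    using that prime_gt_1_nat[of q] in_prime_factors_imp_prime[of q m]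
    by (auto simp: g_def Let_def)
  have q1: "multiplicity p (p - 1) = 0"
    using \<open>prime p\<close> prime_gt_1_nat[of p]
    by (intro not_dvd_imp_multiplicity_0) (auto dest: dvd_imp_le)
  have gp: "multiplicity p (g p) = s"
    using \<open>prime p\<close> prime_gt_1_nat[of p] q1
    by (auto simp: g_def s_def r_def Let_def prime_elem_multiplicity_mult_distrib)
  have gq: "multiplicity p (g q) = multiplicity p (q - 1)" if "q \<in> prime_factors m" "q \<noteq> p" for q
  proof -
    have "prime q"
      using that by auto
    have "multiplicity p (q ^ k) = 0" for k
      using \<open>prime p\<close> \<open>prime q\<close> that(2) by (intro multiplicity_distinct_prime_power) auto
    thus ?thesis
      using \<open>prime p\<close> \<open>prime q\<close> prime_gt_1_nat[of q]
      by (auto simp: g_def Let_def prime_elem_multiplicity_mult_distrib)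
  qed
  \<comment> \<open>Numbers with the same upper bounds \<open>k\<close> are equal.\<close>
  have "multiplicity p (LCM q\<in>prime_factors m. g q) \<le> k \<longleftrightarrow>
      max s (multiplicity p (LCM q\<in>prime_factors m. q - 1)) \<le> k" for k
  proof -
    have "multiplicity p (LCM q\<in>prime_factors m. g q) \<le> k \<longleftrightarrow>
        (\<forall>q\<in>prime_factors m. multiplicity p (g q) \<le> k)"
      using \<open>prime p\<close> gpos by (intro multiplicity_LCM_le_iff) auto
    \<comment> \<open>Only \<open>q = p\<close> gives \<open>s\<close>; the extra entry
      \<open>p - 1\<close> on the right is prime to \<open>p\<close> and imposes nothing.\<close>
    also have "\<dots> \<longleftrightarrow> s \<le> k \<and> (\<forall>q\<in>prime_factors m. multiplicity p (q - 1) \<le> k)"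
    proof (intro iffI conjI ballI)
      fix q assume "\<forall>q\<in>prime_factors m. multiplicity p (g q) \<le> k" "q \<in> prime_factors m"
      thus "multiplicity p (q - 1) \<le> k"
        using gq[of q] q1 by (cases "q = p") auto
    next
      fix q assume "s \<le> k \<and> (\<forall>q\<in>prime_factors m. multiplicity p (q - 1) \<le> k)"
        "q \<in> prime_factors m"
      thus "multiplicity p (g q) \<le> k"
        using gq[of q] gp by (cases "q = p") auto
    qed (use p gp in auto)
    also have "(\<forall>q\<in>prime_factors m. multiplicity p (q - 1) \<le> k) \<longleftrightarrow>
        multiplicity p (LCM q\<in>prime_factors m. q - 1) \<le> k"
      using \<open>prime p\<close> q1pos by (intro multiplicity_LCM_le_iff[symmetric]) auto
    finally show ?thesis
      by simp
  qed
  hence "multiplicity p (LCM q\<in>prime_factors m. g q) =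
      max s (multiplicity p (LCM q\<in>prime_factors m. q - 1))"
    by (intro order.antisym) (blast intro: order.refl)+
  moreover have "Carmichael m = (LCM q\<in>prime_factors m. g q)"
    by (simp only: Carmichael_closed_formula g_def)
  ultimately show ?thesis
    by (simp only: s_def)
qed

text \<open>The shift by -1 in \<open>e_exp\<close> for \<open>p = 2\<close>, \<open>r > 2\<close>
  reflects that \<lambda>(2^r) is 2^(r-2) rather than 2^(r-1).\<close>

lemma multiplicity_Carmichael_e_exp:
  assumes "p \<in> prime_factors m"
  shows "int (multiplicity p (Carmichael m)) + 1 = e_exp m p + int (multiplicity p m)"
proof -
  \<comment> \<open>Keeps the natural subtraction \<open>r - 1\<close> from truncating.\<close>
  have "multiplicity p m > 0"
    using assms by (simp add: prime_factors_multiplicity)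
  thus ?thesis
    by (auto simp: multiplicity_Carmichael[OF assms] e_exp_def Let_def max_def of_nat_diff)
qed

lemma prime_minus_1_dvd_Carmichael:
  assumes "p \<in> prime_factors m"
  shows "p - 1 dvd Carmichael m"
proof -
  let ?g = "\<lambda>q. let k = multiplicity q m
    in if q = 2 \<and> k > 2 then 2 ^ (k - 2) else q ^ (k - 1) * (q - 1)"
  have "p - 1 dvd ?g p"
    by (auto simp: Let_def)
  also have "?g p dvd (LCM q\<in>prime_factors m. ?g q)"
    using assms by (intro dvd_Lcm) auto
  finally show ?thesis
    by (simp only: Carmichael_closed_formula)
qed

section \<open>Divisibility by the square of \<open>m\<close>, one prime at a time\<close>

lemma prod_pairwise_coprime_dvd:
  fixes f :: "'b \<Rightarrow> int"
  assumes "finite A" "\<And>i j. i \<in> A \<Longrightarrow> j \<in> A \<Longrightarrow> i \<noteq> j \<Longrightarrow> coprime (f i) (f j)"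
    and "\<And>i. i \<in> A \<Longrightarrow> f i dvd x"
  shows "(\<Prod>i\<in>A. f i) dvd x"
  using assms
proof (induction A rule: finite_induct)
  case (insert i A)
  have "coprime (f i) (\<Prod>j\<in>A. f j)"
    using insert.hyps(2) by (intro prod_coprime_right insert.prems) auto
  hence "f i * (\<Prod>j\<in>A. f j) dvd x"
    using insert by (intro divides_mult) auto
  thus ?case
    using insert.hyps by simp
qed simp

lemma square_dvd_int_iff_prime_powers:
  fixes m :: nat and x :: int
  assumes "m > 0"
  shows "int m ^ 2 dvd x \<longleftrightarrow> (\<forall>p\<in>prime_factors m. int p ^ (2 * multiplicity p m) dvd x)"
proof -
  have "int m ^ 2 = (\<Prod>p\<in>prime_factors m. int p ^ (2 * multiplicity p m))"
  proof -
    have "m ^ 2 = (\<Prod>p\<in>prime_factors m. p ^ multiplicity p m) ^ 2"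
      using assms prod_prime_factors[of m] by simp
    also have "\<dots> = (\<Prod>p\<in>prime_factors m. p ^ (2 * multiplicity p m))"
      by (simp add: prod_power_distrib power_mult[symmetric] mult.commute)
    finally have "int (m ^ 2) = int (\<Prod>p\<in>prime_factors m. p ^ (2 * multiplicity p m))"
      by simp
    thus ?thesis
      by simp
  qed
  moreover have "(\<Prod>p\<in>prime_factors m. int p ^ (2 * multiplicity p m)) dvd x"
    if "\<forall>p\<in>prime_factors m. int p ^ (2 * multiplicity p m) dvd x"
  proof (intro prod_pairwise_coprime_dvd)
    fix p q assume "p \<in> prime_factors m" "q \<in> prime_factors m" "p \<noteq> q"
    hence "coprime p q"
      by (intro primes_coprime) auto
    thus "coprime (int p ^ (2 * multiplicity p m)) (int q ^ (2 * multiplicity q m))"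
      by simp
  qed (use that in auto)
  moreover have "int p ^ (2 * multiplicity p m) dvd
      (\<Prod>p\<in>prime_factors m. int p ^ (2 * multiplicity p m))" if "p \<in> prime_factors m" for p
    using that by (intro dvd_prodI) auto
  ultimately show ?thesis
    by (auto intro: dvd_trans)
qed

theorem proposition4p7:
  fixes m :: nat and a :: int
  assumes "m \<ge> 3" and "coprime a (int m)"
  shows "Carmichael_Wieferich m a \<longleftrightarrow>
    (\<forall>p\<in>prime_factors m. Fin (e_exp m p) + sigma a p \<ge> Fin (int (multiplicity p m)))"
proof -
  let ?x = "a ^ Carmichael m - 1"
  have "Carmichael_Wieferich m a \<longleftrightarrow> int m dvd Carmichael_quotient m a"
    using assms by (simp add: Carmichael_Wieferich_def cong_0_iff)
  \<comment> \<open>Multiplying by \<open>m\<close> clears the denominator of the quotient.\<close>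
  also have "\<dots> \<longleftrightarrow> int m ^ 2 dvd int m * Carmichael_quotient m a"
    using assms(1) by (simp add: power2_eq_square)
  also have "\<dots> \<longleftrightarrow> int m ^ 2 dvd ?x"
    using assms by (simp add: Carmichael_quotient_mult)
  also have "\<dots> \<longleftrightarrow> (\<forall>p\<in>prime_factors m. int p ^ (2 * multiplicity p m) dvd ?x)"
    using assms(1) by (intro square_dvd_int_iff_prime_powers) auto
  also have "\<dots> \<longleftrightarrow>
      (\<forall>p\<in>prime_factors m. Fin (e_exp m p) + sigma a p \<ge> Fin (int (multiplicity p m)))"
  proof (intro ball_cong refl)
    fix p assume p: "p \<in> prime_factors m"
    hence "prime p" "p dvd m"
      by auto
    have "\<not> int p dvd a"
    proof
      assume "int p dvd a"
      with \<open>p dvd m\<close> have "is_unit (int p)"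
        using assms(2) coprime_common_divisor[of a "int m" "int p"] by simp
      thus False
        using \<open>prime p\<close> not_prime_unit[of p] by simp
    qed
    \<comment> \<open>This is where \<open>m \<ge> 3\<close> matters: \<lambda>(2) = 1 is
      odd.\<close>
    moreover have "even (Carmichael m)"
      using assms(1) by (intro even_Carmichael) simp
    ultimately have "padic_ord p ?x = sigma a p + Fin (int (multiplicity p (Carmichael m)) + 1)"
      using \<open>prime p\<close> prime_minus_1_dvd_Carmichael[OF p]
      by (intro padic_ord_power_diff_1_sigma) auto
    also have "\<dots> = sigma a p + Fin (e_exp m p + int (multiplicity p m))"
      by (simp only: multiplicity_Carmichael_e_exp[OF p])
    finally have x: "padic_ord p ?x = sigma a p + Fin (e_exp m p + int (multiplicity p m))" .
    \<comment> \<open>Both sides compare after cancelling the finite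
      \<open>multiplicity p m\<close>, also when \<open>sigma a p\<close> is infinite.\<close>
    show "int p ^ (2 * multiplicity p m) dvd ?x \<longleftrightarrow>
        Fin (e_exp m p) + sigma a p \<ge> Fin (int (multiplicity p m))"
      unfolding Fin_le_padic_ord_iff[OF \<open>prime p\<close>, symmetric] x
      by (cases "sigma a p") (auto simp: algebra_simps)
  qed
  finally show ?thesis .
qed

end
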